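(* Let $\mathcal{C}\subseteq\mathbb{R}^n$ be a (nonempty) simplex-like polytope, let $f\colon\mathcal{C}\to\mathbb{R}$ be convex and differentiable in an open set containing $\mathcal{C}$, and suppose that $(\mathcal{C},f)$ has extended $L$-curvature for some $L>0$ and satisfies the $(\mu,\theta)$-error bound relative to the face distance $\mathfrak{f}$ for some $\mu>0$ and $\theta\in[0,1/2]$. Then the iterates $\mathbf{x}^{(t)}$, $t\in\mathbb{N}$, of the Frank-Wolfe algorithm with in-face pairwise directions (FWIPW) satisfy the following initial linear convergence rate for $t\in\{0,1,\dots,t_0\}$: $$f(\mathbf{x}^{(t)})-f^*\le\frac{f(\mathbf{x}^{(0)})-f^*}{2^t},$$ where $t_0\in\mathbb{N}$ is the smallest $t$ such that $-\langle\nabla f(\mathbf{x}^{(t)}),\mathbf{d}^{(t)}_{\mathrm{PW}}\rangle<L$. Then the following convergence rates hold: (i) When $\theta=1/2$, the following linear convergence rate holds for all $t\in\mathbb{N}$ with $t\ge t_0$: $$f(\mathbf{x}^{(t)})-f^*\le(f(\mathbf{x}^{(t_0)})-f^* )\left(1-\frac{\mu}{4L}\right)^{t-t_0}.$$ (ii) When $\theta\in[0,1/2)$, the following sublinear convergence rate holds for all $t\in\mathbb{N}$ with $t\ge t_0$: $$f(\mathbf{x}^{(t)})-f^*\le\left((f(\mathbf{x}^{(t_0)})-f^* )^{2\theta-1}+\frac{(1-2\theta)\mu^{2\theta}(t-t_0)}{4L}\right)^{\frac{1}{2\theta-1}}.$$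
   Context: $\mathbb{N}=\{0,1,2,\dots\}$. $f^*=\min_{\mathbf{x}\in\mathcal{C}}f(\mathbf{x})$ and $X^*=\{\mathbf{x}\in\mathcal{C}\mid f(\mathbf{x})=f^*\}$. Simplex-like polytope: a polytope $\mathcal{C}=\{\mathbf{x}\in\mathbb{R}^n\mid A\mathbf{x}=\mathbf{b},\ \mathbf{x}\ge\mathbf{0}\}$, with $A\in\mathbb{R}^{m\times n}$ and $\mathbf{b}\in\mathbb{R}^m$, whose vertices are contained in $\{0,1\}^n$. Extended $L$-curvature: for all $\mathbf{x}\in\mathcal{C}$, $\mathbf{d}\in\mathcal{C}-\mathcal{C}$ and $\eta\ge0$ with $\mathbf{x}+\eta\mathbf{d}\in\mathcal{C}$, $f(\mathbf{x}+\eta\mathbf{d})\le f(\mathbf{x})+\eta\langle\nabla f(\mathbf{x}),\mathbf{d}\rangle+\frac{L\eta^2}{2}$. For $\mathbf{x}\in\mathcal{C}$, $F(\mathbf{x})$ is the minimal face of $\mathcal{C}$ containing $\mathbf{x}$, that is, the face containing $\mathbf{x}$ that is contained in every face of $\mathcal{C}$ containing $\mathbf{x}$. Face distance: $\mathfrak{f}\colon\mathcal{C}\times\mathcal{C}\to[0,1]$, $\mathfrak{f}(\mathbf{y},\mathbf{x})=\min\{\gamma\ge0\mid\mathbf{y}-\mathbf{x}=\gamma(\mathbf{v}-\mathbf{u})\text{ for some }\mathbf{v}\in\mathcal{C}\text{ and }\mathbf{u}\in F(\mathbf{x})\}$. Error bound: for $\mathfrak{d}\colon\mathcal{C}\times\mathcal{C}\to[0,1]$,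 $\mu>0$, $\theta\in[0,1/2]$, $(\mathcal{C},f)$ satisfies the $(\mu,\theta)$-error bound relative to $\mathfrak{d}$ if for all $\mathbf{x}\in\mathcal{C}$, $\left(\frac{f(\mathbf{x})-f^*}{\mu}\right)^\theta\ge\min_{\mathbf{x}^*\in X^*}\mathfrak{d}(\mathbf{x}^*,\mathbf{x})$. Algorithm FWIPW: start at a vertex $\mathbf{x}^{(0)}$ of $\mathcal{C}$ and set $\eta_{-1}=1$. At each iteration $t\in\mathbb{N}$, take vertices $\mathbf{a}^{(t)}\in\arg\max_{\mathbf{y}\in F(\mathbf{x}^{(t)})}\langle\nabla f(\mathbf{x}^{(t)}),\mathbf{y}\rangle$ and $\mathbf{v}^{(t)}\in\arg\min_{\mathbf{y}\in\mathcal{C}}\langle\nabla f(\mathbf{x}^{(t)}),\mathbf{y}\rangle$, and set $\mathbf{d}^{(t)}_{\mathrm{PW}}=\mathbf{v}^{(t)}-\mathbf{a}^{(t)}$, $\gamma_t=-\frac{\langle\nabla f(\mathbf{x}^{(t)}),\mathbf{d}^{(t)}_{\mathrm{PW}}\rangle}{L}$ (with $L$ the extended curvature constant), $\eta_t=\max\{2^{-k_t}\mid k_t\in\mathbb{N},\ 2^{-k_t}\le\min\{\gamma_t,\eta_{t-1}\}\}$, and $\mathbf{x}^{(t+1)}=\mathbf{x}^{(t)}+\eta_t\mathbf{d}^{(t)}_{\mathrm{PW}}$. *)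

theory Defs
  imports "HOL-Analysis.Analysis"
begin

definition std_polyhedron :: "real ^ 'n ^ 'm \<Rightarrow> real ^ 'm \<Rightarrow> (real ^ 'n) set" where
  "std_polyhedron A b = {x. A *v x = b \<and> (\<forall>i. 0 \<le> x $ i)}"

definition simplex_like_polytope ::
    "(real ^ 'n) set \<Rightarrow> real ^ 'n ^ 'm \<Rightarrow> real ^ 'm \<Rightarrow> bool" where
  "simplex_like_polytope C A b \<longleftrightarrow>
     polytope C \<and> C = std_polyhedron A b \<and>
     (\<forall>v. v extreme_point_of C \<longrightarrow> (\<forall>i. v $ i \<in> {0, 1}))"

definition grad :: "('a::real_inner \<Rightarrow> real) \<Rightarrow> 'a \<Rightarrow> 'a" where
  "grad f x = (THE D. GDERIV f x :> D)"

(* The infima below are minima for nonempty compact C and f continuous on C: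
   see min_value_attained, face_dist_attained and min_face_dist_attained. *)

definition min_value :: "'a set \<Rightarrow> ('a \<Rightarrow> real) \<Rightarrow> real" where
  "min_value C f = (INF x\<in>C. f x)"

definition minimizers :: "'a set \<Rightarrow> ('a \<Rightarrow> real) \<Rightarrow> 'a set" where
  "minimizers C f = {x \<in> C. f x = min_value C f}"

definition extended_curvature ::
    "'a::real_inner set \<Rightarrow> ('a \<Rightarrow> real) \<Rightarrow> real \<Rightarrow> bool" where
  "extended_curvature C f L \<longleftrightarrow>
     (\<forall>x\<in>C. \<forall>d\<in>{y - z | y z. y \<in> C \<and> z \<in> C}. \<forall>\<eta>\<ge>0. x + \<eta> *\<^sub>R d \<in> C \<longrightarrow>
        f (x + \<eta> *\<^sub>R d) \<le> f x + \<eta> * (grad f x \<bullet> d) + L * \<eta>\<^sup>2 / 2)"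

definition min_face :: "'a::euclidean_space set \<Rightarrow> 'a \<Rightarrow> 'a set" where
  "min_face C x = \<Inter>{T. T face_of C \<and> x \<in> T}"

definition face_dist :: "'a::euclidean_space set \<Rightarrow> 'a \<Rightarrow> 'a \<Rightarrow> real" where
  "face_dist C y x =
     Inf {\<gamma>. 0 \<le> \<gamma> \<and> (\<exists>v\<in>C. \<exists>u\<in>min_face C x. y - x = \<gamma> *\<^sub>R (v - u))}"

(* For \<theta> = 0 and f x = min_value C f, powr gives 0 where 0^0 = 1 might be read; this is
   harmless for face_dist, whose minimum over the minimizers is then 0 (face_dist_self). *)
definition error_bound ::
    "'a set \<Rightarrow> ('a \<Rightarrow> real) \<Rightarrow> real \<Rightarrow> real \<Rightarrow> ('a \<Rightarrow> 'a \<Rightarrow> real) \<Rightarrow> bool" where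
  "error_bound C f \<mu> \<theta> \<dd> \<longleftrightarrow>
     (\<forall>x\<in>C. ((f x - min_value C f) / \<mu>) powr \<theta> \<ge> (INF x'\<in>minimizers C f. \<dd> x' x))"

(* The set of admissible powers of 1/2 is empty iff m <= 0. In the algorithm this means
   \<gamma>_t = 0, i.e. the current iterate is a minimizer; with step size 0 the iterates then
   stay constant. *)
definition dyadic_floor :: "real \<Rightarrow> real" where
  "dyadic_floor m =
     (if \<exists>k::nat. (1/2) ^ k \<le> m then (GREATEST s. \<exists>k::nat. s = (1/2) ^ k \<and> s \<le> m) else 0)"

(* x t, a t, v t, \<eta> t are the iterate, the away vertex, the Frank-Wolfe vertex and the step
   size of iteration t; the step size "before iteration 0" is 1. *)
definition fwipw ::
    "'a::euclidean_space set \<Rightarrow> ('a \<Rightarrow> real) \<Rightarrow> real \<Rightarrow>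
     (nat \<Rightarrow> 'a) \<Rightarrow> (nat \<Rightarrow> 'a) \<Rightarrow> (nat \<Rightarrow> 'a) \<Rightarrow> (nat \<Rightarrow> real) \<Rightarrow> bool" where
  "fwipw C f L x a v \<eta> \<longleftrightarrow>
     x 0 extreme_point_of C \<and>
     (\<forall>t. a t extreme_point_of C \<and>
          is_arg_max (\<lambda>y. grad f (x t) \<bullet> y) (\<lambda>y. y \<in> min_face C (x t)) (a t) \<and>
          v t extreme_point_of C \<and>
          is_arg_min (\<lambda>y. grad f (x t) \<bullet> y) (\<lambda>y. y \<in> C) (v t) \<and>
          \<eta> t = dyadic_floor (min (- (grad f (x t) \<bullet> (v t - a t)) / L)
                                  (case t of 0 \<Rightarrow> 1 | Suc s \<Rightarrow> \<eta> s)) \<and>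
          x (Suc t) = x t + \<eta> t *\<^sub>R (v t - a t))"


lemma GDERIV_grad:
  fixes f :: "'a::euclidean_space \<Rightarrow> real"
  assumes "f differentiable (at x)"
  shows "GDERIV f x :> grad f x"
proof -
  obtain f' where f': "(f has_derivative f') (at x)"
    using assms by (auto simp: differentiable_def)
  then have lin: "linear f'" by (simp add: has_derivative_linear)
  have eq: "f' = (\<lambda>h. h \<bullet> adjoint f' 1)"
    using adjoint_works[OF lin, of _ 1] by (auto simp: fun_eq_iff)
  have ex: "GDERIV f x :> adjoint f' 1"
    unfolding gderiv_def using f' eq by simp
  have "D = adjoint f' 1" if "GDERIV f x :> D" for D
  proof -
    have "(\<lambda>h. h \<bullet> D) = f'"
      using that f' unfolding gderiv_def by (blast intro: has_derivative_unique)
    then have "\<forall>h. h \<bullet> D = h \<bullet> adjoint f' 1" using eq by metis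
    then show ?thesis using vector_eq_ldot by blast
  qed
  with ex show ?thesis unfolding grad_def by (rule theI)
qed

lemma min_face_props:
  assumes "convex C" "x \<in> C"
  shows "min_face C x face_of C" "x \<in> min_face C x"
    and "\<And>T. T face_of C \<Longrightarrow> x \<in> T \<Longrightarrow> min_face C x \<subseteq> T"
proof -
  have "C face_of C" using assms face_of_refl by blast
  with assms show "min_face C x face_of C"
    unfolding min_face_def by (intro face_of_Inter) auto
qed (auto simp: min_face_def)

lemma dyadic_floor_greatest:
  assumes "0 < m"
  shows "\<exists>k::nat. dyadic_floor m = (1/2) ^ k" "dyadic_floor m \<le> m"
    and "\<And>k::nat. (1/2) ^ k \<le> m \<Longrightarrow> (1/2) ^ k \<le> dyadic_floor m"
proof -
  have ex: "\<exists>k::nat. (1/2::real) ^ k \<le> m"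
    using real_arch_pow_inv[of m "1/2"] assms by (auto intro: less_imp_le)
  define k where "k = (LEAST k::nat. (1/2::real) ^ k \<le> m)"
  have k: "(1/2::real) ^ k \<le> m" unfolding k_def using ex by (rule LeastI_ex)
  have le: "(1/2::real) ^ j \<le> (1/2) ^ k" if "(1/2::real) ^ j \<le> m" for j
    using that by (intro power_decreasing) (auto simp: k_def intro: Least_le)
  have "(GREATEST s. \<exists>k::nat. s = (1/2::real) ^ k \<and> s \<le> m) = (1/2) ^ k"
    by (rule Greatest_equality) (use k le in auto)
  then have eq: "dyadic_floor m = (1/2) ^ k" using ex by (simp add: dyadic_floor_def)
  show "\<exists>k::nat. dyadic_floor m = (1/2) ^ k" "dyadic_floor m \<le> m"
    "\<And>k::nat. (1/2) ^ k \<le> m \<Longrightarrow> (1/2) ^ k \<le> dyadic_floor m"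
    using eq k le by auto
qed

lemma min_value_attained:
  fixes C :: "'a::topological_space set"
  assumes "compact C" "C \<noteq> {}" "continuous_on C f"
  shows "\<exists>x\<in>C. f x = min_value C f \<and> (\<forall>y\<in>C. f x \<le> f y)"
proof -
  obtain x where x: "x \<in> C" "\<And>y. y \<in> C \<Longrightarrow> f x \<le> f y"
    using continuous_attains_inf[OF assms] by auto
  have "min_value C f = f x"
    unfolding min_value_def by (rule cInf_eq_minimum) (use x in auto)
  with x show ?thesis by auto
qed

lemma compact_face_dist_aux:
  fixes C :: "'a::euclidean_space set"
  assumes "compact C" "convex C" "x \<in> C" "compact S"
  shows "compact {\<gamma>. 0 \<le> \<gamma> \<and> \<gamma> \<le> 1 \<and>
           (\<exists>y\<in>S. \<exists>v\<in>C. \<exists>u\<in>min_face C x. y - x = \<gamma> *\<^sub>R (v - u))}" (is "compact ?K")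
proof -
  let ?P = "{0..1::real} \<times> S \<times> C \<times> min_face C x"
  let ?h = "\<lambda>p::real \<times> 'a \<times> 'a \<times> 'a.
              fst (snd p) - x - fst p *\<^sub>R (fst (snd (snd p)) - snd (snd (snd p)))"
  have cF: "compact (min_face C x)"
    using assms min_face_props(1) face_of_imp_compact by blast
  have cP: "compact ?P"
    using assms cF by (intro compact_Times) auto
  have "closed {p. ?h p = 0}"
    by (intro closed_Collect_eq continuous_intros)
  then have "compact (?P \<inter> {p. ?h p = 0})" using cP by (rule compact_Int_closed[rotated])
  then have c: "compact (fst ` (?P \<inter> {p. ?h p = 0}))"
    by (intro compact_continuous_image continuous_intros)
  have "?K = fst ` (?P \<inter> {p. ?h p = 0})"
  proof (intro set_eqI iffI)
    fix g assume "g \<in> ?K"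
    then obtain y v u where "0 \<le> g" "g \<le> 1" "y \<in> S" "v \<in> C" "u \<in> min_face C x"
      "y - x = g *\<^sub>R (v - u)" by blast
    then show "g \<in> fst ` (?P \<inter> {p. ?h p = 0})"
      by (intro image_eqI[where x = "(g, y, v, u)"]) auto
  next
    fix g assume "g \<in> fst ` (?P \<inter> {p. ?h p = 0})"
    then show "g \<in> ?K" by fastforce
  qed
  with c show ?thesis by simp
qed

lemma face_dist_attained:
  fixes C :: "'a::euclidean_space set"
  assumes "compact C" "convex C" "x \<in> C" "y \<in> C"
  shows "face_dist C y x \<in> {0..1}"
    and "\<exists>v\<in>C. \<exists>u\<in>min_face C x. y - x = face_dist C y x *\<^sub>R (v - u)"
    and "\<And>\<gamma> v u. 0 \<le> \<gamma> \<Longrightarrow> v \<in> C \<Longrightarrow> u \<in> min_face C x \<Longrightarrow> y - x = \<gamma> *\<^sub>R (v - u)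
           \<Longrightarrow> face_dist C y x \<le> \<gamma>"
proof -
  let ?Q = "\<lambda>\<gamma>. \<exists>v\<in>C. \<exists>u\<in>min_face C x. y - x = \<gamma> *\<^sub>R (v - u)"
  let ?K = "{\<gamma>. 0 \<le> \<gamma> \<and> \<gamma> \<le> 1 \<and> ?Q \<gamma>}"
  have cK: "compact ?K" using compact_face_dist_aux[OF assms(1,2,3), of "{y}"] by simp
  have 1: "1 \<in> ?K" using assms min_face_props(2)[OF assms(2,3)] by auto
  then have "?K \<noteq> {}" by blast
  from compact_attains_inf[OF cK this]
  obtain g where g: "g \<in> ?K" "\<And>h. h \<in> ?K \<Longrightarrow> g \<le> h" by blast
  have least: "g \<le> h" if "0 \<le> h" "?Q h" for h
    by (cases "h \<le> 1") (use that g 1 in force)+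
  have eq: "face_dist C y x = g"
    unfolding face_dist_def by (rule cInf_eq_minimum) (use g(1) least in auto)
  show "face_dist C y x \<in> {0..1}" "?Q (face_dist C y x)" using g(1) eq by auto
  show "face_dist C y x \<le> \<gamma>" if "0 \<le> \<gamma>" "v \<in> C" "u \<in> min_face C x" "y - x = \<gamma> *\<^sub>R (v - u)"
    for \<gamma> v u
    using least[OF that(1)] that eq by blast
qed

lemma face_dist_self:
  fixes C :: "'a::euclidean_space set"
  assumes "compact C" "convex C" "x \<in> C"
  shows "face_dist C x x = 0"
  using face_dist_attained(1)[OF assms assms(3)]
    face_dist_attained(3)[OF assms assms(3), of 0 x x] assms(3) min_face_props(2)[OF assms(2,3)]
  by auto

lemma min_face_dist_attained:
  fixes C :: "'a::euclidean_space set"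
  assumes "compact C" "convex C" "continuous_on C f" "x \<in> C"
  shows "\<exists>x'\<in>minimizers C f. face_dist C x' x = (INF x'\<in>minimizers C f. face_dist C x' x) \<and>
           (\<forall>y\<in>minimizers C f. face_dist C x' x \<le> face_dist C y x)"
proof -
  let ?M = "minimizers C f"
  let ?Q = "\<lambda>\<gamma> y. \<exists>v\<in>C. \<exists>u\<in>min_face C x. y - x = \<gamma> *\<^sub>R (v - u)"
  let ?K = "{\<gamma>. 0 \<le> \<gamma> \<and> \<gamma> \<le> 1 \<and> (\<exists>y\<in>?M. ?Q \<gamma> y)}"
  have sub: "?M \<subseteq> C" by (auto simp: minimizers_def)
  have ne: "?M \<noteq> {}"
    using min_value_attained[OF assms(1) _ assms(3)] assms(4) by (auto simp: minimizers_def)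
  have "closed ?M"
    unfolding minimizers_def
    using continuous_closed_preimage_constant[OF assms(3)] assms(1) compact_imp_closed by blast
  then have cM: "compact ?M"
    using compact_Int_closed[OF assms(1), of ?M] sub by (simp add: Int_absorb1)
  have fd: "face_dist C y x \<in> ?K" if "y \<in> ?M" for y
    using face_dist_attained(1,2)[OF assms(1,2,4), of y] that sub by auto
  have "?K \<noteq> {}" using ne fd by blast
  from compact_attains_inf[OF compact_face_dist_aux[OF assms(1,2,4) cM] this]
  obtain g where g: "g \<in> ?K" "\<And>h. h \<in> ?K \<Longrightarrow> g \<le> h" by blast
  then obtain z where z: "z \<in> ?M" "?Q g z" by blast
  have "face_dist C z x \<le> g"
    using face_dist_attained(3)[OF assms(1,2,4), of z] z g(1) sub by blast
  then have least: "face_dist C z x \<le> face_dist C y x" if "y \<in> ?M" for y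
    using g(2)[OF fd[OF that]] by linarith
  have "(INF y\<in>?M. face_dist C y x) = face_dist C z x"
    by (rule cInf_eq_minimum) (use z least in auto)
  with z least show ?thesis by auto
qed

end

theory Submission
  imports Defs
begin

text \<open>
  Write \<open>h t = f (x t) - f*\<close> for the gap and \<open>D t = - grad f (x t) \<bullet> (v t - a t)\<close> for the pairwise
  gap, so that the tentative step is \<open>\<gamma> t = D t / L\<close>.

  \<^emph>\<open>Feasibility.\<close> Step sizes are nonincreasing powers of \<open>1/2\<close> and vertices are 0/1 vectors, so all
  coordinates of \<open>x t\<close> are integer multiples of the previous step size (a step size of 0 arises
  only from \<open>\<gamma> t = 0\<close> or from a zero predecessor, and then the iterate stays put). The away vertex lies in the
  minimal face of \<open>x t\<close> and hence vanishes wherever \<open>x t\<close> does; where it equals 1, the coordinate of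
  \<open>x t\<close> is therefore at least the previous step size, and subtracting the new step keeps it
  nonnegative (\<open>fwipw_iterate_in_lattice\<close>).

  \<^emph>\<open>Descent.\<close> As \<open>\<eta> t \<le> \<gamma> t\<close>, the curvature inequality gives a decrease of at least
  \<open>\<eta> t * D t / 2\<close>. Convexity and the definition of the face distance give \<open>h t \<le> \<dd> * D t\<close>, where
  \<open>\<dd> \<le> 1\<close> is the face distance from \<open>x t\<close> to the minimizers (\<open>gap_le_face_dist_mult\<close>). While
  \<open>D t \<ge> L\<close>, the step size is 1 and the gap is halved; this phase ends because each such step
  decreases \<open>f\<close> by at least \<open>L/2\<close>.

  \<^emph>\<open>Steps that are not short.\<close> The step size is capped by its predecessor, so \<open>\<eta> t\<close> can be much
  smaller than \<open>\<gamma> t\<close>. But its value was set at some iteration \<open>s \<le> t\<close>, where \<open>\<gamma> s \<le> 2 * \<eta> t\<close>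
  (\<open>fwipw_step_lower_bound\<close>). As long as the gap is positive, the error bound reads \<open>D r \<ge> \<mu> powr \<theta> * h r powr (1 - \<theta>)\<close> at \<open>r = s\<close> and at
  \<open>r = t\<close>, and \<open>h s \<ge> h t\<close>, so the decrease is at least
  \<open>D s * D t / (4 * L) \<ge> \<mu> powr (2 * \<theta>) * h t powr (2 - 2 * \<theta>) / (4 * L)\<close>.
  Solving this recurrence gives both rates (\<open>linear_recurrence_bound\<close>,
  \<open>sublinear_recurrence_bound\<close>).
\<close>


section \<open>Convexity and minimal faces\<close>

lemma convex_on_gradient_le:
  assumes cvx: "convex_on C f" and xy: "x \<in> C" "y \<in> C" and der: "GDERIV f x :> g"
  shows "g \<bullet> (y - x) \<le> f y - f x"
proof -
  let ?d = "y - x"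
  have fd: "(f has_derivative (\<lambda>h. h \<bullet> g)) (at (x + 0 *\<^sub>R ?d))"
    using der by (simp add: gderiv_def)
  have "((\<lambda>s. f (x + s *\<^sub>R ?d)) has_derivative (\<lambda>s. (s *\<^sub>R ?d) \<bullet> g)) (at 0)"
    by (rule has_derivative_compose[of "\<lambda>s. x + s *\<^sub>R ?d" "\<lambda>s. s *\<^sub>R ?d", OF _ fd])
      (auto intro!: derivative_eq_intros)
  then have "((\<lambda>s. f (x + s *\<^sub>R ?d)) has_real_derivative (?d \<bullet> g)) (at 0)"
    by (simp add: has_field_derivative_def mult_commute_abs)
  then have "((\<lambda>s. (f (x + s *\<^sub>R ?d) - f x) / s) \<longlongrightarrow> ?d \<bullet> g) (at 0)"
    by (simp add: DERIV_def)
  then have "((\<lambda>s. (f (x + s *\<^sub>R ?d) - f x) / s) \<longlongrightarrow> ?d \<bullet> g) (at_right 0)"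
    by (rule filterlim_mono) (auto simp: at_le)
  moreover have "\<forall>\<^sub>F s in at_right 0. (f (x + s *\<^sub>R ?d) - f x) / s \<le> f y - f x"
  proof (rule eventually_at_rightI[of 0 1])
    fix s :: real assume s: "s \<in> {0<..<1}"
    have "f ((1 - s) *\<^sub>R x + s *\<^sub>R y) \<le> (1 - s) * f x + s * f y"
      using s xy by (intro convex_onD[OF cvx]) auto
    moreover have "(1 - s) *\<^sub>R x + s *\<^sub>R y = x + s *\<^sub>R ?d" by (simp add: algebra_simps)
    ultimately show "(f (x + s *\<^sub>R ?d) - f x) / s \<le> f y - f x"
      using s by (simp add: divide_simps algebra_simps)
  qed simp
  ultimately have "?d \<bullet> g \<le> f y - f x"
    by (rule tendsto_upperbound) simp
  then show ?thesis by (simp add: inner_commute)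
qed

lemma min_value_le:
  fixes C :: "'a::topological_space set"
  assumes "compact C" "continuous_on C f" "x \<in> C"
  shows "min_value C f \<le> f x"
  using min_value_attained[OF assms(1) _ assms(2)] assms(3) by fastforce

text \<open>The definition of the face distance writes \<open>x' - x\<close> as a multiple of some \<open>w - u\<close> with \<open>u\<close>
  in the minimal face of \<open>x\<close> and \<open>w\<close> in \<open>C\<close>; the maximality of \<open>a\<close> on that face and the minimality
  of \<open>v\<close> on \<open>C\<close> bound \<open>grad f x \<bullet> (u - w)\<close> by the pairwise gap.\<close>

lemma gap_le_face_dist_mult:
  fixes C :: "'a::euclidean_space set"
  assumes C: "compact C" "convex C" and f: "convex_on C f" "continuous_on C f"
    and x: "x \<in> C" and der: "GDERIV f x :> grad f x"
    and a: "is_arg_max (\<lambda>y. grad f x \<bullet> y) (\<lambda>y. y \<in> min_face C x) a"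
    and v: "is_arg_min (\<lambda>y. grad f x \<bullet> y) (\<lambda>y. y \<in> C) v"
  shows "f x - min_value C f \<le>
    (INF x'\<in>minimizers C f. face_dist C x' x) * - (grad f x \<bullet> (v - a))"
    and "(INF x'\<in>minimizers C f. face_dist C x' x) \<in> {0..1}"
proof -
  obtain y where y: "y \<in> minimizers C f"
      "face_dist C y x = (INF x'\<in>minimizers C f. face_dist C x' x)"
    using min_face_dist_attained[OF C f(2) x] by blast
  then have yC: "y \<in> C" and fy: "f y = min_value C f" by (auto simp: minimizers_def)
  note fd = face_dist_attained[OF C x yC]
  obtain w u where wu: "w \<in> C" "u \<in> min_face C x" "y - x = face_dist C y x *\<^sub>R (w - u)"
    using fd(2) by blast
  have "grad f x \<bullet> u \<le> grad f x \<bullet> a" "grad f x \<bullet> v \<le> grad f x \<bullet> w"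
    using a v wu by (auto simp: is_arg_max_def is_arg_min_def not_less)
  then have "- (grad f x \<bullet> (w - u)) \<le> - (grad f x \<bullet> (v - a))" by (simp add: inner_diff_right)
  then have le: "face_dist C y x * - (grad f x \<bullet> (w - u))
      \<le> face_dist C y x * - (grad f x \<bullet> (v - a))"
    using fd(1) by (intro mult_left_mono) auto
  have "grad f x \<bullet> (y - x) = face_dist C y x * (grad f x \<bullet> (w - u))"
    using wu(3) by simp
  then have "f x - min_value C f \<le> face_dist C y x * - (grad f x \<bullet> (w - u))"
    using convex_on_gradient_le[OF f(1) x yC der] fy by simp
  with le y(2) show "f x - min_value C f \<le>
    (INF x'\<in>minimizers C f. face_dist C x' x) * - (grad f x \<bullet> (v - a))" by simp
  show "(INF x'\<in>minimizers C f. face_dist C x' x) \<in> {0..1}"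
    using fd(1) y(2) by simp
qed

text \<open>The points of the polyhedron with vanishing \<open>i\<close>-th coordinate form a face.\<close>

lemma min_face_std_polyhedron_zero:
  assumes "convex (std_polyhedron A b)" "x \<in> std_polyhedron A b"
    and "y \<in> min_face (std_polyhedron A b) x" "x $ i = 0"
  shows "y $ i = 0"
proof -
  let ?T = "std_polyhedron A b \<inter> {z. axis i 1 \<bullet> z = 0}"
  have "?T face_of std_polyhedron A b"
    by (rule face_of_Int_supporting_hyperplane_ge[OF assms(1)])
      (auto simp: std_polyhedron_def inner_axis inner_commute[of "axis _ _"])
  moreover have "x \<in> ?T"
    using assms by (simp add: inner_axis inner_commute[of "axis _ _"])
  ultimately have "y \<in> ?T"
    using min_face_props(3)[OF assms(1,2)] assms(3) by blast
  then show ?thesis by (simp add: inner_axis inner_commute[of "axis _ _"])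
qed


section \<open>Dyadic step sizes\<close>

definition dyadic_steps :: "real set" where
  "dyadic_steps = insert 0 (range (\<lambda>k::nat. (1/2) ^ k))"

lemma dyadic_floor_nonpos:
  assumes "m \<le> 0"
  shows "dyadic_floor m = 0"
proof -
  have "m < (1/2) ^ k" for k :: nat
    by (rule le_less_trans[OF assms]) simp
  then have "\<not> (\<exists>k::nat. (1/2) ^ k \<le> m)" by (simp add: not_le)
  then show ?thesis by (simp only: dyadic_floor_def if_False)
qed

text \<open>The cap on the step size is the only reason for a step shorter than half of the tentative
  one: a dyadic cap that is active is attained exactly.\<close>

lemma dyadic_floor_min:
  assumes \<gamma>: "0 \<le> \<gamma>" and \<delta>: "\<delta> \<in> dyadic_steps" and r: "r = dyadic_floor (min \<gamma> \<delta>)"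
  shows "r \<in> dyadic_steps" "0 \<le> r" "r \<le> \<gamma>" "r \<le> \<delta>" "r = \<delta> \<or> \<gamma> < \<delta> \<and> \<gamma> \<le> 2 * r"
proof -
  have \<delta>0: "0 \<le> \<delta>" and \<delta>1: "\<delta> \<le> 1"
    using \<delta> by (auto simp: dyadic_steps_def power_le_one)
  have "r \<in> dyadic_steps \<and> 0 \<le> r \<and> r \<le> \<gamma> \<and> r \<le> \<delta> \<and> (r = \<delta> \<or> \<gamma> < \<delta> \<and> \<gamma> \<le> 2 * r)"
  proof (cases "0 < min \<gamma> \<delta>")
    case False
    then have "min \<gamma> \<delta> \<le> 0" by (simp only: not_less)
    then have "r = 0" unfolding r by (rule dyadic_floor_nonpos)
    with False \<gamma> \<delta>0 show ?thesis
      by (auto simp: dyadic_steps_def min_def split: if_splits)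
  next
    case True
    note g = dyadic_floor_greatest[OF True, folded r]
    obtain k :: nat where k: "r = (1/2) ^ k" using g(1) by blast
    have "r = \<delta> \<or> \<gamma> < \<delta> \<and> \<gamma> \<le> 2 * r"
    proof (cases "\<delta> \<le> \<gamma>")
      case True
      moreover obtain j :: nat where "\<delta> = (1/2) ^ j"
        using \<delta> \<open>0 < min \<gamma> \<delta>\<close> by (auto simp: dyadic_steps_def)
      ultimately show ?thesis using g(2) g(3)[of j] by simp
    next
      case False
      show ?thesis
      proof (cases k)
        case 0
        then show ?thesis using k False \<delta>1 by simp
      next
        case (Suc j)
        then have "\<not> (1/2::real) ^ j \<le> (1/2) ^ k" by simp
        then have "\<not> (1/2::real) ^ j \<le> min \<gamma> \<delta>" using g(3)[of j] k by auto
        then show ?thesis using k Suc False by simp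
      qed
    qed
    then show ?thesis using g(2) k by (auto simp: dyadic_steps_def)
  qed
  then show "r \<in> dyadic_steps" "0 \<le> r" "r \<le> \<gamma>" "r \<le> \<delta>" "r = \<delta> \<or> \<gamma> < \<delta> \<and> \<gamma> \<le> 2 * r"
    by blast+
qed

lemma dyadic_steps_multiple:
  assumes "r \<in> dyadic_steps" "\<delta> \<in> dyadic_steps" "0 < r" "r \<le> \<delta>"
  obtains z :: int where "\<delta> = of_int z * r"
proof -
  obtain j k :: nat where jk: "r = (1/2) ^ k" "\<delta> = (1/2) ^ j"
    using assms by (auto simp: dyadic_steps_def)
  have "j \<le> k"
    using assms(4) power_strict_decreasing[of k j "1/2::real"] unfolding jk
    by (cases "j \<le> k") auto
  then have "(2::real) ^ k = 2 ^ (k - j) * 2 ^ j" by (simp flip: power_add)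
  then have "\<delta> = of_int (2 ^ (k - j)) * r"
    by (simp add: jk power_one_over field_simps)
  then show thesis by (rule that)
qed


section \<open>Feasibility of the iterates\<close>

lemma std_polyhedron_pairwise_step:
  fixes A :: "real ^ 'n ^ 'm"
  assumes cvx: "convex (std_polyhedron A b)" and x: "x \<in> std_polyhedron A b"
    and v: "v \<in> std_polyhedron A b" and a: "a \<in> min_face (std_polyhedron A b) x"
    and a01: "\<And>i. a $ i \<in> {0, 1}"
    and lattice: "\<And>i. \<exists>z::int. x $ i = of_int z * \<delta>"
    and r: "0 \<le> r" "r \<le> \<delta>"
  shows "x + r *\<^sub>R (v - a) \<in> std_polyhedron A b"
proof -
  have aP: "a \<in> std_polyhedron A b"
    using min_face_props(1)[OF cvx x] a face_of_imp_subset by blast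
  have "A *v (x + r *\<^sub>R (v - a)) = b"
    using x v aP by (simp add: std_polyhedron_def matrix_vector_right_distrib
        matrix_vector_mult_diff_distrib matrix_vector_mult_scaleR)
  moreover have "0 \<le> (x + r *\<^sub>R (v - a)) $ i" for i
  proof -
    have nonneg: "0 \<le> x $ i" "0 \<le> v $ i" using x v by (auto simp: std_polyhedron_def)
    have "r * a $ i \<le> x $ i"
    proof (cases "a $ i = 0")
      case False
      then have a1: "a $ i = 1" using a01[of i] by auto
      have "x $ i \<noteq> 0" using min_face_std_polyhedron_zero[OF cvx x a] False by blast
      then have pos: "0 < x $ i" using nonneg by simp
      obtain z :: int where z: "x $ i = of_int z * \<delta>" using lattice by blast
      with pos r have "0 < z" by (auto simp: zero_less_mult_iff)
      then have "1 * \<delta> \<le> of_int z * \<delta>" using r by (intro mult_right_mono) auto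
      then show ?thesis using z a1 r by simp
    qed (use nonneg in simp)
    moreover have "0 \<le> r * v $ i" using nonneg r by simp
    ultimately show ?thesis by (simp add: algebra_simps)
  qed
  ultimately show ?thesis by (simp add: std_polyhedron_def)
qed

lemma fwipw_pairwise_gap_nonneg:
  assumes "fwipw C f L x a v \<eta>"
  shows "0 \<le> - (grad f (x t) \<bullet> (v t - a t))"
proof -
  have "is_arg_min (\<lambda>y. grad f (x t) \<bullet> y) (\<lambda>y. y \<in> C) (v t)" "a t \<in> C"
    using assms by (auto simp: fwipw_def extreme_point_of_def)
  then show ?thesis by (auto simp: is_arg_min_def inner_diff_right not_less)
qed

text \<open>The term \<open>case_nat 1 \<eta> t\<close> is the step size of the iteration before \<open>t\<close>.
  Multiples of it are multiples of the new step size as well, unless the latter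
  is 0 and the iterate does not move.\<close>

lemma fwipw_iterate_in_lattice:
  fixes A :: "real ^ 'n ^ 'm"
  assumes simplex: "simplex_like_polytope C A b" and L: "0 < L" and fw: "fwipw C f L x a v \<eta>"
  shows "x t \<in> C \<and> case_nat 1 \<eta> t \<in> dyadic_steps \<and>
    (case_nat 1 \<eta> t \<noteq> 0 \<longrightarrow> (\<forall>i. \<exists>z::int. x t $ i = of_int z * case_nat 1 \<eta> t))"
proof (induction t)
  have C: "C = std_polyhedron A b" "convex C"
    and vert: "\<And>w i. w extreme_point_of C \<Longrightarrow> w $ i \<in> {0, 1}"
    using simplex by (auto simp: simplex_like_polytope_def polytope_imp_convex)
  {
    case 0
    have x0: "x 0 extreme_point_of C" using fw by (auto simp: fwipw_def)
    have "\<exists>z::int. x 0 $ i = of_int z" for i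
      using vert[OF x0, of i] by (auto intro: exI[of _ 0] exI[of _ 1])
    moreover have "(1::real) \<in> dyadic_steps"
      by (auto simp: dyadic_steps_def intro: image_eqI[of _ _ 0])
    ultimately show ?case using x0 by (auto simp: extreme_point_of_def)
  next
    case (Suc t)
    let ?\<gamma> = "- (grad f (x t) \<bullet> (v t - a t)) / L"
    have \<gamma>: "0 \<le> ?\<gamma>"
      using fwipw_pairwise_gap_nonneg[OF fw, of t] L by (intro divide_nonneg_pos) auto
    have at: "a t extreme_point_of C" "a t \<in> min_face C (x t)"
      and vt: "v t extreme_point_of C"
      and \<eta>: "\<eta> t = dyadic_floor (min ?\<gamma> (case_nat 1 \<eta> t))"
      and xS: "x (Suc t) = x t + \<eta> t *\<^sub>R (v t - a t)"
      using fw by (auto simp: fwipw_def is_arg_max_def)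
    have \<delta>: "case_nat 1 \<eta> t \<in> dyadic_steps" and xC: "x t \<in> C" using Suc.IH by auto
    note step = dyadic_floor_min[OF \<gamma> \<delta> \<eta>]
    show ?case
    proof (cases "\<eta> t = 0")
      case True
      then show ?thesis using xS xC step(1) by simp
    next
      case False
      then have pos: "0 < \<eta> t" using step(2) by simp
      then have lat: "\<exists>z::int. x t $ i = of_int z * case_nat 1 \<eta> t" for i
        using Suc.IH step(4) by auto
      have "x (Suc t) \<in> C"
        unfolding xS C(1)
        by (rule std_polyhedron_pairwise_step[where \<delta> = "case_nat 1 \<eta> t"])
          (use C vert at vt xC lat step in \<open>auto simp: extreme_point_of_def\<close>)
      moreover have "\<exists>z::int. x (Suc t) $ i = of_int z * \<eta> t" for i
      proof -
        obtain p :: int where p: "x t $ i = of_int p * case_nat 1 \<eta> t" using lat by blast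
        obtain q :: int where q: "case_nat 1 \<eta> t = of_int q * \<eta> t"
          using dyadic_steps_multiple[OF step(1) \<delta> pos step(4)] by blast
        have "v t $ i \<in> range of_int" "a t $ i \<in> range of_int"
          using vert[OF at(1), of i] vert[OF vt, of i] Ints_0 Ints_1 by (auto simp: Ints_def)
        then obtain m n :: int where "v t $ i = of_int m" "a t $ i = of_int n" by auto
        moreover have "x (Suc t) $ i = x t $ i + \<eta> t * (v t $ i - a t $ i)" by (simp add: xS)
        ultimately have "x (Suc t) $ i = of_int (p * q + (m - n)) * \<eta> t"
          using p q by (simp add: algebra_simps)
        then show ?thesis by blast
      qed
      ultimately show ?thesis using step(1) by simp
    qed
  }
qed


section \<open>Descent along the iterates\<close>

lemma fwipw_step_size:
  fixes A :: "real ^ 'n ^ 'm"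
  assumes simplex: "simplex_like_polytope C A b" and L: "0 < L" and fw: "fwipw C f L x a v \<eta>"
  defines "\<gamma> \<equiv> \<lambda>t. - (grad f (x t) \<bullet> (v t - a t)) / L"
  shows "0 \<le> \<eta> t" "\<eta> t \<le> \<gamma> t" "\<eta> t \<le> case_nat 1 \<eta> t"
    "\<eta> t = case_nat 1 \<eta> t \<or> \<gamma> t < case_nat 1 \<eta> t \<and> \<gamma> t \<le> 2 * \<eta> t"
proof -
  have \<gamma>: "0 \<le> \<gamma> t"
    using fwipw_pairwise_gap_nonneg[OF fw, of t] L unfolding \<gamma>_def
    by (intro divide_nonneg_pos) auto
  have \<delta>: "case_nat 1 \<eta> t \<in> dyadic_steps"
    using fwipw_iterate_in_lattice[OF simplex L fw] by blast
  have \<eta>: "\<eta> t = dyadic_floor (min (\<gamma> t) (case_nat 1 \<eta> t))"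
    using fw by (simp add: fwipw_def \<gamma>_def)
  show "0 \<le> \<eta> t" "\<eta> t \<le> \<gamma> t" "\<eta> t \<le> case_nat 1 \<eta> t"
    "\<eta> t = case_nat 1 \<eta> t \<or> \<gamma> t < case_nat 1 \<eta> t \<and> \<gamma> t \<le> 2 * \<eta> t"
    using dyadic_floor_min(2-5)[OF \<gamma> \<delta> \<eta>] by simp_all
qed

text \<open>The curvature term \<open>L * (\<eta> t)\<^sup>2 / 2\<close> uses up at most half of the first-order decrease,
  since \<open>\<eta> t\<close> does not exceed the minimizer \<open>\<gamma> t\<close> of the quadratic upper model.\<close>

lemma fwipw_descent:
  fixes A :: "real ^ 'n ^ 'm"
  assumes simplex: "simplex_like_polytope C A b" and L: "0 < L" and fw: "fwipw C f L x a v \<eta>"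
    and curv: "extended_curvature C f L"
  shows "f (x (Suc t)) \<le> f (x t) - \<eta> t * - (grad f (x t) \<bullet> (v t - a t)) / 2"
proof -
  let ?D = "- (grad f (x t) \<bullet> (v t - a t))"
  note step = fwipw_step_size[OF simplex L fw, of t]
  have C: "x t \<in> C" "x (Suc t) \<in> C"
    using fwipw_iterate_in_lattice[OF simplex L fw] by blast+
  have va: "v t \<in> C" "a t \<in> C" and xS: "x (Suc t) = x t + \<eta> t *\<^sub>R (v t - a t)"
    using fw by (auto simp: fwipw_def extreme_point_of_def)
  have "v t - a t \<in> {y - z | y z. y \<in> C \<and> z \<in> C}" using va by blast
  then have "f (x (Suc t)) \<le> f (x t) - \<eta> t * ?D + L * (\<eta> t)\<^sup>2 / 2"
    using curv[unfolded extended_curvature_def, rule_format, OF C(1), of "v t - a t" "\<eta> t"]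
      C(2) step(1) unfolding xS by simp
  moreover have "L * (\<eta> t)\<^sup>2 \<le> \<eta> t * ?D"
  proof -
    have "\<eta> t * L \<le> ?D" using step(2) L by (simp add: field_simps)
    then have "\<eta> t * (\<eta> t * L) \<le> \<eta> t * ?D" using step(1) by (rule mult_left_mono)
    then show ?thesis by (simp add: power2_eq_square mult_ac)
  qed
  ultimately show ?thesis by linarith
qed

text \<open>The index \<open>s\<close> is the last iteration up to \<open>t\<close> at which the step size dropped; there is
  one because \<open>\<gamma> t0 < 1\<close> forces a drop at \<open>t0\<close> at the latest.\<close>

lemma fwipw_step_lower_bound:
  fixes A :: "real ^ 'n ^ 'm"
  assumes simplex: "simplex_like_polytope C A b" and L: "0 < L" and fw: "fwipw C f L x a v \<eta>"
    and t0: "- (grad f (x t0) \<bullet> (v t0 - a t0)) < L" and one: "case_nat 1 \<eta> t0 = 1"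
    and t: "t0 \<le> t"
  shows "\<exists>s\<le>t. - (grad f (x s) \<bullet> (v s - a s)) \<le> 2 * L * \<eta> t"
proof -
  note step = fwipw_step_size[OF simplex L fw]
  show ?thesis
    using t
  proof (induction t rule: dec_induct)
    case base
    have "- (grad f (x t0) \<bullet> (v t0 - a t0)) / L < 1"
      using t0 L by (subst pos_divide_less_eq) auto
    then have "\<eta> t0 \<noteq> 1" using step(2)[of t0] by linarith
    then have "- (grad f (x t0) \<bullet> (v t0 - a t0)) / L \<le> 2 * \<eta> t0"
      using step(4)[of t0] one by simp
    then have "- (grad f (x t0) \<bullet> (v t0 - a t0)) \<le> 2 * \<eta> t0 * L"
      by (simp only: pos_divide_le_eq[OF L])
    then show ?case by (intro exI[of _ t0]) (simp add: mult_ac)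
  next
    case (step t)
    from fwipw_step_size(4)[OF simplex L fw, of "Suc t"] show ?case
    proof
      assume "\<eta> (Suc t) = case_nat 1 \<eta> (Suc t)"
      then have "\<eta> (Suc t) = \<eta> t" by simp
      then show ?thesis using step.IH le_SucI by metis
    next
      assume "- (grad f (x (Suc t)) \<bullet> (v (Suc t) - a (Suc t))) / L < case_nat 1 \<eta> (Suc t) \<and>
        - (grad f (x (Suc t)) \<bullet> (v (Suc t) - a (Suc t))) / L \<le> 2 * \<eta> (Suc t)"
      then have "- (grad f (x (Suc t)) \<bullet> (v (Suc t) - a (Suc t))) \<le> 2 * \<eta> (Suc t) * L"
        by (simp only: pos_divide_le_eq[OF L])
      then show ?thesis by (intro exI[of _ "Suc t"]) (simp add: mult_ac)
    qed
  qed
qed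

text \<open>The error bound, multiplied by the pairwise gap \<open>D\<close> and solved for \<open>D\<close>. The hypothesis
  \<open>0 < h\<close> allows cancelling \<open>h powr \<theta>\<close>.\<close>

lemma error_bound_pairwise_gap:
  fixes h D \<mu> \<theta> :: real
  assumes "0 < h" "0 < \<mu>" "h \<le> (h / \<mu>) powr \<theta> * D"
  shows "\<mu> powr \<theta> * h powr (1 - \<theta>) \<le> D"
proof -
  have "h * \<mu> powr \<theta> \<le> h powr \<theta> * D"
    using assms by (simp add: powr_divide field_simps)
  moreover have "h = h powr \<theta> * h powr (1 - \<theta>)"
    using assms(1) by (simp flip: powr_add)
  ultimately have "h powr \<theta> * (\<mu> powr \<theta> * h powr (1 - \<theta>)) \<le> h powr \<theta> * D"
    by (metis mult.assoc mult.commute)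
  then show ?thesis using assms(1) by simp
qed


section \<open>Solving the recurrences\<close>

text \<open>A negative ratio \<open>q\<close> forces the sequence to vanish.\<close>

lemma linear_recurrence_bound:
  fixes h :: "nat \<Rightarrow> real"
  assumes nonneg: "\<And>n. 0 \<le> h n" and rec: "\<And>n. h (Suc n) \<le> q * h n"
  shows "h n \<le> h 0 * q ^ n"
proof (cases "h 0 = 0")
  case True
  have "h n \<le> 0"
  proof (induction n)
    case (Suc n)
    then have "h n = 0" using nonneg[of n] by simp
    then show ?case using rec[of n] by simp
  qed (simp add: True)
  then show ?thesis using True by simp
next
  case False
  then have "0 < h 0" using nonneg[of 0] by simp
  moreover have "0 \<le> q * h 0" using rec[of 0] nonneg[of 1] by simp
  ultimately have q: "0 \<le> q" by (simp add: zero_le_mult_iff)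
  show ?thesis
  proof (induction n)
    case (Suc n)
    have "h (Suc n) \<le> q * (h 0 * q ^ n)"
      using rec[of n] mult_left_mono[OF Suc q] by linarith
    then show ?case by (simp add: mult_ac)
  qed simp
qed

text \<open>The power \<open>h n powr (- \<beta>)\<close> grows by at least \<open>\<beta> * c\<close> in each step, because
  \<open>(1 - u) powr (- \<beta>) \<ge> exp (\<beta> * u) \<ge> 1 + \<beta> * u\<close>, here with \<open>u = c * h n powr \<beta>\<close>.\<close>

lemma sublinear_recurrence_bound:
  fixes h :: "nat \<Rightarrow> real"
  assumes nonneg: "\<And>n. 0 \<le> h n" and rec: "\<And>n. h (Suc n) \<le> h n - c * h n powr (1 + \<beta>)"
    and c: "0 \<le> c" and \<beta>: "0 < \<beta>"
  shows "h n \<le> (if h 0 = 0 then 0 else (h 0 powr (- \<beta>) + \<beta> * c * real n) powr (- 1 / \<beta>))"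
proof -
  have mono: "h (Suc n) \<le> h n" for n
    using rec[of n] mult_nonneg_nonneg[OF c, of "h n powr (1 + \<beta>)"] by simp
  have grow: "h 0 powr (- \<beta>) + \<beta> * c * real n \<le> h n powr (- \<beta>)" if "0 < h n" for n
    using that
  proof (induction n)
    case (Suc n)
    have hn: "0 < h n" using mono[of n] Suc.prems by linarith
    define u where "u = c * h n powr \<beta>"
    have "h (Suc n) \<le> h n * (1 - u)"
      using rec[of n] hn by (simp add: u_def powr_add algebra_simps)
    moreover from this have "0 < 1 - u"
      using Suc.prems hn by (meson less_le_trans zero_less_mult_pos)
    ultimately have "(h n * (1 - u)) powr (- \<beta>) \<le> h (Suc n) powr (- \<beta>)"
      using Suc.prems \<beta> by (intro powr_mono2') auto
    moreover have "1 + \<beta> * u \<le> (1 - u) powr (- \<beta>)"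
    proof -
      have "ln (1 - u) \<le> - u" using ln_le_minus_one[OF \<open>0 < 1 - u\<close>] by simp
      then have "\<beta> * u \<le> - \<beta> * ln (1 - u)" using mult_left_mono[of _ _ \<beta>] \<beta> by fastforce
      then have "exp (\<beta> * u) \<le> (1 - u) powr (- \<beta>)"
        using \<open>0 < 1 - u\<close> by (simp add: powr_def)
      then show ?thesis using exp_ge_add_one_self[of "\<beta> * u"] by linarith
    qed
    then have "h n powr (- \<beta>) * (1 + \<beta> * u) \<le> (h n * (1 - u)) powr (- \<beta>)"
      using hn \<open>0 < 1 - u\<close> by (simp add: powr_mult mult_left_mono)
    moreover have "h n powr (- \<beta>) * (1 + \<beta> * u) = h n powr (- \<beta>) + \<beta> * c"
      using hn by (simp add: u_def algebra_simps powr_minus divide_simps)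
    moreover have "\<beta> * c * real (Suc n) = \<beta> * c * real n + \<beta> * c" by (simp add: algebra_simps)
    ultimately show ?case using Suc.IH[OF hn] by linarith
  qed simp
  show ?thesis
  proof (cases "h n = 0")
    case False
    then have pos: "0 < h n" using nonneg[of n] by simp
    have "h n \<le> h 0" by (rule lift_Suc_antimono_le[of h]) (use mono in auto)
    then have h0: "0 < h 0" using pos by simp
    define B where "B = h 0 powr (- \<beta>) + \<beta> * c * real n"
    have "0 < B" unfolding B_def using h0 \<beta> c by (intro add_pos_nonneg) auto
    then have "(h n powr (- \<beta>)) powr (- 1 / \<beta>) \<le> B powr (- 1 / \<beta>)"
      using grow[OF pos] \<beta> by (intro powr_mono2') (auto simp: B_def)
    then show ?thesis using pos h0 \<beta> by (simp add: powr_powr B_def)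
  qed simp
qed


section \<open>Convergence rates\<close>

theorem theorem3p18:
  fixes C U :: "(real ^ 'n) set" and A :: "real ^ 'n ^ 'm" and b :: "real ^ 'm"
    and f :: "real ^ 'n \<Rightarrow> real" and L \<mu> \<theta> :: real
    and x a v :: "nat \<Rightarrow> real ^ 'n" and \<eta> :: "nat \<Rightarrow> real"
  assumes "simplex_like_polytope C A b" and "C \<noteq> {}"
    and "convex_on C f"
    and "open U" and "C \<subseteq> U" and "f differentiable_on U"
    and "L > 0" and "extended_curvature C f L"
    and "\<mu> > 0" and "0 \<le> \<theta>" and "\<theta> \<le> 1/2"
    and "error_bound C f \<mu> \<theta> (face_dist C)"
    and "fwipw C f L x a v \<eta>"
  shows "\<exists>t0.
      - (grad f (x t0) \<bullet> (v t0 - a t0)) < L \<and>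
      (\<forall>t<t0. \<not> - (grad f (x t) \<bullet> (v t - a t)) < L) \<and>
      (\<forall>t\<le>t0. f (x t) - min_value C f \<le> (f (x 0) - min_value C f) / 2 ^ t) \<and>
      (\<theta> = 1/2 \<longrightarrow>
        (\<forall>t\<ge>t0. f (x t) - min_value C f
           \<le> (f (x t0) - min_value C f) * (1 - \<mu> / (4 * L)) ^ (t - t0))) \<and>
      (\<theta> < 1/2 \<longrightarrow>
        (\<forall>t\<ge>t0. f (x t) - min_value C f
           \<le> (if f (x t0) = min_value C f then 0
              else ((f (x t0) - min_value C f) powr (2 * \<theta> - 1)
                    + (1 - 2 * \<theta>) * \<mu> powr (2 * \<theta>) * real (t - t0) / (4 * L))
                   powr (1 / (2 * \<theta> - 1)))))"
proof -
  define h where "h t = f (x t) - min_value C f" for t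
  define D where "D t = - (grad f (x t) \<bullet> (v t - a t))" for t
  note simplex = assms(1) and L = assms(7) and curv = assms(8) and \<mu> = assms(9) and fw = assms(13)
  note step = fwipw_step_size[OF simplex L fw, folded D_def]
  have C: "compact C" "convex C"
    using simplex by (auto simp: simplex_like_polytope_def polytope_imp_compact polytope_imp_convex)
  have cont: "continuous_on C f"
    using differentiable_imp_continuous_on[OF assms(6)] assms(5) continuous_on_subset by blast
  have xC: "x t \<in> C" for t using fwipw_iterate_in_lattice[OF simplex L fw] by blast
  have h0: "0 \<le> h t" for t using min_value_le[OF C(1) cont xC] by (simp add: h_def)
  have D0: "0 \<le> D t" for t using fwipw_pairwise_gap_nonneg[OF fw] by (simp add: D_def)
  have descent: "h (Suc t) \<le> h t - \<eta> t * D t / 2" for t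
    using fwipw_descent[OF simplex L fw curv, of t] by (simp add: h_def D_def)
  have mono: "h t \<le> h s" if "s \<le> t" for s t
  proof (rule lift_Suc_antimono_le[OF _ that])
    fix n show "h (Suc n) \<le> h n"
      using descent[of n] mult_nonneg_nonneg[OF step(1)[of n] D0[of n]] by linarith
  qed
  define dist where "dist t = (INF x'\<in>minimizers C f. face_dist C x' (x t))" for t
  have gap: "h t \<le> dist t * D t" and dist: "dist t \<in> {0..1}" for t
  proof -
    have "f differentiable (at (x t))"
      using assms(4-6) xC differentiable_on_eq_differentiable_at by blast
    then have "GDERIV f (x t) :> grad f (x t)" by (rule GDERIV_grad)
    moreover have "is_arg_max (\<lambda>y. grad f (x t) \<bullet> y) (\<lambda>y. y \<in> min_face C (x t)) (a t)"
      "is_arg_min (\<lambda>y. grad f (x t) \<bullet> y) (\<lambda>y. y \<in> C) (v t)"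
      using fw by (auto simp: fwipw_def)
    ultimately show "h t \<le> dist t * D t" "dist t \<in> {0..1}"
      using gap_le_face_dist_mult[OF C assms(3) cont xC] by (auto simp: h_def dist_def D_def)
  qed
  have hD: "h t \<le> D t" for t
    using gap[of t] mult_right_mono[of "dist t" 1, OF _ D0[of t]] dist[of t] by simp

  have full: "\<eta> t = 1 \<and> h (Suc t) \<le> h t - D t / 2" if "case_nat 1 \<eta> t = 1" "L \<le> D t" for t
  proof -
    have "1 \<le> D t / L" using that(2) L by simp
    then have "\<eta> t = 1" using step(4)[of t] that(1) by simp
    then show ?thesis using descent[of t] by simp
  qed
  have one: "case_nat 1 \<eta> t = 1" if "\<And>s. s < t \<Longrightarrow> L \<le> D s" for t
    using that
  proof (induction t)
    case (Suc t)
    then have "case_nat 1 \<eta> t = 1" by simp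
    then show ?case using full[of t] Suc.prems by simp
  qed simp

  have "\<exists>t. D t < L"
  proof (rule ccontr)
    assume "\<not> (\<exists>t. D t < L)"
    then have large: "L \<le> D t" for t by (simp add: not_less)
    \<comment> \<open>full steps forever would push \<open>f\<close> below its minimum\<close>
    have "h t \<le> h 0 - real t * (L / 2)" for t
    proof (induction t)
      case (Suc t)
      have "h (Suc t) \<le> h t - D t / 2" using full[OF one large] large by blast
      then show ?case using large[of t] Suc.IH by (simp add: field_simps)
    qed simp
    moreover obtain n :: nat where "h 0 < real n * (L / 2)"
      using reals_Archimedean3[of "L / 2"] L by auto
    ultimately show False using h0[of n] by (metis diff_less_0_iff_less less_le_trans not_le)
  qed
  define t0 where "t0 = (LEAST t. D t < L)"
  have t0: "D t0 < L" unfolding t0_def using \<open>\<exists>t. D t < L\<close> by (rule LeastI_ex)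
  have before: "L \<le> D t" if "t < t0" for t
    using not_less_Least that unfolding t0_def by (metis not_less)

  have initial: "h t \<le> h 0 / 2 ^ t" if "t \<le> t0" for t
    using that
  proof (induction t)
    case (Suc t)
    have "h (Suc t) \<le> h t - D t / 2" using full[OF one] before Suc.prems by simp
    also have "\<dots> \<le> h t / 2" using hD[of t] by simp
    also have "\<dots> \<le> (h 0 / 2 ^ t) / 2" using Suc by (intro divide_right_mono) auto
    finally show ?case by (simp add: mult.commute)
  qed simp

  have error_bound: "\<mu> powr \<theta> * h t powr (1 - \<theta>) \<le> D t" if "0 < h t" for t
  proof (rule error_bound_pairwise_gap[OF that \<mu>])
    have "dist t \<le> (h t / \<mu>) powr \<theta>"
      using assms(12) xC by (auto simp: error_bound_def dist_def h_def)
    then show "h t \<le> (h t / \<mu>) powr \<theta> * D t"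
      using gap[of t] mult_right_mono[OF _ D0[of t]] by fastforce
  qed

  define c where "c = \<mu> powr (2 * \<theta>) / (4 * L)"
  have c: "0 \<le> c" using L by (simp add: c_def)
  have recurrence: "h (Suc t) \<le> h t - c * h t powr (1 + (1 - 2 * \<theta>))" if "t0 \<le> t" for t
  proof (cases "h t = 0")
    case True
    then show ?thesis using mono[of t "Suc t"] by simp
  next
    case False
    then have pos: "0 < h t" using h0[of t] by simp
    \<comment> \<open>\<open>M\<close> is a lower bound both of \<open>D t\<close> and of the pairwise gap \<open>D s\<close> that determined the current
      step size; the decrease is at least \<open>M * M / (4 * L)\<close>.\<close>
    define M where "M = \<mu> powr \<theta> * h t powr (1 - \<theta>)"
    have M0: "0 \<le> M" by (simp add: M_def)
    obtain s where s: "s \<le> t" "D s \<le> 2 * L * \<eta> t"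
      using fwipw_step_lower_bound[OF simplex L fw t0[unfolded D_def] one[OF before] \<open>t0 \<le> t\<close>]
      unfolding D_def by blast
    have "h t powr (1 - \<theta>) \<le> h s powr (1 - \<theta>)"
      using mono[OF s(1)] pos assms(11) by (intro powr_mono2) auto
    then have "M \<le> \<mu> powr \<theta> * h s powr (1 - \<theta>)"
      unfolding M_def by (rule mult_left_mono) simp
    also have "\<dots> \<le> D s" using error_bound[of s] mono[OF s(1)] pos by simp
    finally have "M \<le> 2 * L * \<eta> t" using s(2) by simp
    moreover have "M \<le> D t" using error_bound[OF pos] by (simp add: M_def)
    ultimately have "M * M \<le> (2 * L * \<eta> t) * D t"
      using M0 L step(1)[of t] by (intro mult_mono) auto
    then have "M * M / (4 * L) \<le> \<eta> t * D t / 2"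
      using L by (simp add: field_simps)
    moreover have "M * M / (4 * L) = c * h t powr (1 + (1 - 2 * \<theta>))"
    proof -
      have "M * M = (\<mu> powr \<theta> * \<mu> powr \<theta>) * (h t powr (1 - \<theta>) * h t powr (1 - \<theta>))"
        by (simp add: M_def mult_ac)
      also have "\<dots> = \<mu> powr (2 * \<theta>) * h t powr (1 + (1 - 2 * \<theta>))"
        by (simp flip: powr_add)
      finally show ?thesis by (simp add: c_def)
    qed
    ultimately show ?thesis using descent[of t] by simp
  qed

  have linear: "h t \<le> h t0 * (1 - \<mu> / (4 * L)) ^ (t - t0)" if "\<theta> = 1/2" "t0 \<le> t" for t
  proof -
    have "h (t0 + Suc n) \<le> (1 - \<mu> / (4 * L)) * h (t0 + n)" for n
      using recurrence[of "t0 + n"] that(1) h0[of "t0 + n"] \<mu> by (simp add: c_def algebra_simps)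
    then show ?thesis
      using linear_recurrence_bound[of "\<lambda>n. h (t0 + n)" _ "t - t0"] h0 that(2) by simp
  qed

  have sublinear: "h t \<le> (if h t0 = 0 then 0 else (h t0 powr (2 * \<theta> - 1)
      + (1 - 2 * \<theta>) * \<mu> powr (2 * \<theta>) * real (t - t0) / (4 * L)) powr (1 / (2 * \<theta> - 1)))"
    if "\<theta> < 1/2" "t0 \<le> t" for t
  proof -
    have "h (t0 + (t - t0)) \<le> (if h (t0 + 0) = 0 then 0
        else (h (t0 + 0) powr - (1 - 2 * \<theta>) + (1 - 2 * \<theta>) * c * real (t - t0))
          powr (- 1 / (1 - 2 * \<theta>)))"
      by (rule sublinear_recurrence_bound[where h = "\<lambda>n. h (t0 + n)"])
        (use h0 recurrence c that(1) in simp_all)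
    moreover have "- 1 / (1 - 2 * \<theta>) = 1 / (2 * \<theta> - 1)"
      using that(1) by (simp add: field_simps)
    moreover have "(1 - 2 * \<theta>) * c * real (t - t0)
        = (1 - 2 * \<theta>) * \<mu> powr (2 * \<theta>) * real (t - t0) / (4 * L)"
      by (simp add: c_def)
    moreover have "- (1 - 2 * \<theta>) = 2 * \<theta> - 1" by simp
    ultimately show ?thesis using that(2) by (simp only: le_add_diff_inverse add_0_right)
  qed

  show ?thesis
    using t0 before initial linear sublinear
    unfolding h_def D_def right_minus_eq not_less
    by (intro exI[of _ t0] conjI) blast+
qed

end
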